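(* A domain $D\subseteq\{0,1\}^n$ admits a monotone non-dictatorial aggregator of some arity if and only if it admits a binary non-dictatorial aggregator.
   Context: Standing assumption: domains are non-degenerate (projection onto each coordinate is $\{0,1\}$). A $k$-ary aggregator for $D$ ($k\ge2$) is an $n$-tuple $(f_1,\ldots,f_n)$ of unanimous functions $f_j:\{0,1\}^k\to\{0,1\}$ such that whenever $x^1,\ldots,x^k\in D$, $(f_1(x^1_1,\ldots,x^k_1),\ldots,f_n(x^1_n,\ldots,x^k_n))\in D$; it is dictatorial if $f_1=\cdots=f_n={\rm pr}^k_d$ for some $d$; it is monotone if for every $j$ and $i$, $f_j(a_1,\ldots,a_{i-1},0,a_{i+1},\ldots,a_k)=1$ implies $f_j(a_1,\ldots,a_{i-1},1,a_{i+1},\ldots,a_k)=1$. *)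

theory Defs
  imports "HOL-Analysis.Finite_Cartesian_Product"
begin

text \<open>
  The set $\{0,1\}^n$ is \<^typ>\<open>bool ^ 'n\<close> with $n$ the cardinality of the finite index
  type. The arity $k$ varies inside statements, so a $k$-tuple is a list of length $k$ (positions
  counted from 0), and a function $\{0,1\}^k \to \{0,1\}$ is a function on \<^typ>\<open>bool list\<close> of
  which only the values at lists of length $k$ matter.
\<close>

definition nondegenerate :: "(bool ^ 'n) set \<Rightarrow> bool" where
  "nondegenerate D \<longleftrightarrow> (\<forall>j. (\<lambda>x. x $ j) ` D = UNIV)"

definition unanimous :: "nat \<Rightarrow> (bool list \<Rightarrow> bool) \<Rightarrow> bool" where
  "unanimous k g \<longleftrightarrow> (\<forall>b. g (replicate k b) = b)"

text \<open>
  In the closure condition, \<open>xs\<close> lists the $k$ elements of \<open>D\<close>, and \<open>f j\<close> is applied to the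
  list of their \<open>j\<close>-th coordinates.
\<close>

definition aggregator :: "(bool ^ 'n) set \<Rightarrow> nat \<Rightarrow> ('n \<Rightarrow> bool list \<Rightarrow> bool) \<Rightarrow> bool" where
  "aggregator D k f \<longleftrightarrow>
     k \<ge> 2 \<and>
     (\<forall>j. unanimous k (f j)) \<and>
     (\<forall>xs. length xs = k \<and> set xs \<subseteq> D \<longrightarrow> (\<chi> j. f j (map (\<lambda>x. x $ j) xs)) \<in> D)"

definition dictatorial :: "nat \<Rightarrow> ('n \<Rightarrow> bool list \<Rightarrow> bool) \<Rightarrow> bool" where
  "dictatorial k f \<longleftrightarrow> (\<exists>d<k. \<forall>j a. length a = k \<longrightarrow> f j a = a ! d)"

definition monotone_aggregator :: "nat \<Rightarrow> ('n \<Rightarrow> bool list \<Rightarrow> bool) \<Rightarrow> bool" where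
  "monotone_aggregator k f \<longleftrightarrow>
     (\<forall>j a. \<forall>i<k. length a = k \<longrightarrow> f j (a[i := False]) \<longrightarrow> f j (a[i := True]))"

end

theory Submission
  imports Defs
begin

text \<open>
  Suppose that a monotone non-dictatorial aggregator exists but that every binary aggregator is
  dictatorial. Identifying its \<open>k\<close> arguments into two blocks then shows that all components of the
  aggregator are one monotone self-dual function, so the sets of positions at which the value is
  true form a family \<open>W\<close> that is closed under supersets and contains exactly one of \<open>S\<close> and its
  complement. If \<open>W\<close> were closed under intersections it would be a principal ultrafilter and the
  aggregator would be dictatorial. Hence there are \<open>U, V \<in> W\<close> with \<open>U \<inter> V \<notin> W\<close>, and identifying
  arguments along the blocks \<open>U \<inter> V\<close>, \<open>U - V\<close>, \<open>- U\<close> yields the ternary majority function.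
  Fixing the first argument of majority to an element of \<open>D\<close> gives a binary aggregator all of whose
  components are conjunctions or disjunctions.
\<close>

text \<open>Positions from \<open>k\<close> on are ignored, so plain complements and
  \<open>UNIV\<close> can be used without restricting to \<open>{..<k}\<close>.\<close>

definition indicator_list :: "nat \<Rightarrow> nat set \<Rightarrow> bool list" where
  "indicator_list k S = map (\<lambda>i. i \<in> S) [0..<k]"

lemma length_indicator_list [simp]: "length (indicator_list k S) = k"
  by (simp add: indicator_list_def)

lemma nth_indicator_list [simp]: "i < k \<Longrightarrow> indicator_list k S ! i \<longleftrightarrow> i \<in> S"
  by (simp add: indicator_list_def)

lemma indicator_list_cong: "S \<inter> {..<k} = T \<inter> {..<k} \<Longrightarrow> indicator_list k S = indicator_list k T"
  by (rule nth_equalityI; simp) blast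

lemma indicator_list_UNIV: "indicator_list k UNIV = replicate k True"
  by (rule nth_equalityI) simp_all

lemma indicator_list_empty: "indicator_list k {} = replicate k False"
  by (rule nth_equalityI) simp_all

lemma indicator_list_nth: "length a = k \<Longrightarrow> indicator_list k {i. a ! i} = a"
  by (rule nth_equalityI) simp_all

lemma indicator_list_update:
  "(indicator_list k S)[i := b] = indicator_list k (if b then insert i S else S - {i})"
  by (rule nth_equalityI; cases "i < k") (auto simp: nth_list_update)

lemma length_2_cases:
  assumes "length a = 2"
  obtains x y where "a = [x, y]"
  using assms by (auto simp: numeral_2_eq_2 length_Suc_conv)

text \<open>Changing one entry of a pair from False to True either starts at the constant pair False
  or ends at the constant pair True, where unanimity fixes the value.\<close>

lemma monotone_aggregator_binary:
  assumes "\<forall>j. unanimous 2 (f j)"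
  shows "monotone_aggregator 2 f"
  unfolding monotone_aggregator_def
proof (intro allI impI)
  fix j and a :: "bool list" and i :: nat
  assume i: "i < 2" and len: "length a = 2" and f: "f j (a[i := False])"
  have u: "f j [True, True]" "\<not> f j [False, False]"
    using assms by (auto simp: unanimous_def numeral_2_eq_2 dest!: spec[of _ j])
  obtain x y where a: "a = [x, y]"
    using len by (rule length_2_cases)
  from i have "i = 0 \<or> i = 1" by auto
  with f u show "f j (a[i := True])"
    by (cases x; cases y) (auto simp: a)
qed

text \<open>The elements of \<open>T\<close> below \<open>k\<close> are added to \<open>S\<close>
  one at a time, each by a single-coordinate step.\<close>

lemma monotone_aggregator_mono:
  assumes mono: "monotone_aggregator k f" and sub: "S \<subseteq> T"
    and f: "f j (indicator_list k S)"
  shows "f j (indicator_list k T)"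
proof -
  have "f j (indicator_list k (S \<union> X))" if "finite X" for X
    using that
  proof induction
    case empty
    then show ?case using f by simp
  next
    case (insert x X)
    show ?case
    proof (cases "x < k \<and> x \<notin> S")
      case True
      have "f j ((indicator_list k (S \<union> X))[x := False])"
        using insert True by (simp add: indicator_list_update)
      then have "f j ((indicator_list k (S \<union> X))[x := True])"
        using mono True by (simp add: monotone_aggregator_def)
      then show ?thesis by (simp add: indicator_list_update)
    next
      case False
      then have "indicator_list k (S \<union> insert x X) = indicator_list k (S \<union> X)"
        by (intro indicator_list_cong) auto
      then show ?thesis using insert by simp
    qed
  qed
  from this[of "T \<inter> {..<k}"] have "f j (indicator_list k (S \<union> T \<inter> {..<k}))" by simp
  moreover have "indicator_list k (S \<union> T \<inter> {..<k}) = indicator_list k T"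
    using sub by (intro indicator_list_cong) auto
  ultimately show ?thesis by simp
qed

text \<open>
  The arguments in \<open>A\<close> are fixed to the coordinate of a given vector \<open>d\<close>, those in \<open>B - A\<close> are
  identified with the first argument, and the remaining ones with the second.
\<close>

definition binary_minor ::
  "nat \<Rightarrow> ('n \<Rightarrow> bool list \<Rightarrow> bool) \<Rightarrow> bool ^ 'n \<Rightarrow> nat set \<Rightarrow> nat set \<Rightarrow> 'n \<Rightarrow> bool list \<Rightarrow> bool"
  where "binary_minor k f d A B j a =
    f j (indicator_list k {i. if i \<in> A then d $ j else if i \<in> B then a ! 0 else a ! 1})"

text \<open>Closure is inherited by feeding \<open>f\<close> copies of \<open>d\<close>,
  \<open>x\<close> and \<open>y\<close>, all in \<open>D\<close>. Unanimity may be lost by fixing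
  arguments to \<open>d\<close>, so it is assumed.\<close>

lemma aggregator_binary_minor:
  fixes D :: "(bool ^ 'n) set"
  assumes agg: "aggregator D k f" and d: "d \<in> D"
    and una: "\<And>j. unanimous 2 (binary_minor k f d A B j)"
  shows "aggregator D 2 (binary_minor k f d A B)"
  unfolding aggregator_def
proof (intro conjI allI impI)
  fix xs :: "(bool ^ 'n) list"
  assume xs: "length xs = 2 \<and> set xs \<subseteq> D"
  then obtain x y where xy: "xs = [x, y]" by (meson length_2_cases)
  define ys where "ys = map (\<lambda>i. if i \<in> A then d else if i \<in> B then x else y) [0..<k]"
  have "length ys = k" "set ys \<subseteq> D"
    using xs d by (auto simp: ys_def xy)
  then have "(\<chi> j. f j (map (\<lambda>x. x $ j) ys)) \<in> D"
    using agg by (simp add: aggregator_def)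
  moreover have "f j (map (\<lambda>x. x $ j) ys) = binary_minor k f d A B j (map (\<lambda>x. x $ j) xs)" for j
    unfolding binary_minor_def
    by (rule arg_cong[where f = "f j"], rule nth_equalityI) (auto simp: ys_def xy)
  ultimately show "(\<chi> j. binary_minor k f d A B j (map (\<lambda>x. x $ j) xs)) \<in> D"
    by simp
qed (use una in auto)

lemma dictatorial_2_neq:
  assumes "dictatorial 2 g"
  shows "g j [False, True] \<longleftrightarrow> \<not> g j [True, False]" "g i [True, False] \<longleftrightarrow> g j [True, False]"
proof -
  obtain p where "p < 2" "\<forall>j a. length a = 2 \<longrightarrow> g j a = a ! p"
    using assms unfolding dictatorial_def by blast
  moreover from \<open>p < 2\<close> have "p = 0 \<or> p = 1" by auto
  ultimately show "g j [False, True] \<longleftrightarrow> \<not> g j [True, False]"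
    "g i [True, False] \<longleftrightarrow> g j [True, False]"
    by (elim disjE; simp)+
qed

lemma not_dictatorial_imp_binary:
  fixes D :: "(bool ^ 'n::finite) set"
  assumes ne: "D \<noteq> {}" and agg: "aggregator D k f" and mono: "monotone_aggregator k f"
    and nondict: "\<not> dictatorial k f"
  shows "\<exists>g. aggregator D 2 g \<and> \<not> dictatorial 2 g"
proof (rule ccontr)
  assume "\<not> ?thesis"
  then have dict: "dictatorial 2 g" if "aggregator D 2 g" for g
    using that by blast
  obtain d where d: "d \<in> D" using ne by blast
  have una: "f j (replicate k b) = b" for j b
    using agg by (simp add: aggregator_def unanimous_def)
  have top: "f j (indicator_list k UNIV)" and bot: "\<not> f j (indicator_list k {})" for j
    by (simp_all add: indicator_list_UNIV indicator_list_empty una)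

  have two_blocks: "dictatorial 2 (binary_minor k f d {} S)" for S
  proof (intro dict aggregator_binary_minor[OF agg d])
    show "unanimous 2 (binary_minor k f d {} S j)" for j
      unfolding unanimous_def
    proof
      fix b
      show "binary_minor k f d {} S j (replicate 2 b) = b"
        using top bot by (cases b) (simp_all add: binary_minor_def numeral_2_eq_2)
    qed
  qed
  define W where "W = {S. \<forall>j. f j (indicator_list k S)}"
  have minor: "binary_minor k f d {} S j [True, False] = f j (indicator_list k S)"
    "binary_minor k f d {} S j [False, True] = f j (indicator_list k (- S))" for S j
    by (simp_all add: binary_minor_def Compl_eq)
  \<comment> \<open>All components of a dictatorial minor agree at \<open>[True, False]\<close>, so
    membership in \<open>W\<close> can be tested on a single component.\<close>
  have f_W: "f j (indicator_list k S) \<longleftrightarrow> S \<in> W" for S j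
    using dictatorial_2_neq(2)[OF two_blocks[of S]] by (auto simp: minor W_def)
  have compl_W: "- S \<in> W \<longleftrightarrow> S \<notin> W" for S
    using dictatorial_2_neq(1)[OF two_blocks[of S]] by (auto simp: minor f_W)
  have mono_W: "T \<in> W" if "S \<in> W" "S \<subseteq> T" for S T
    using monotone_aggregator_mono[OF mono that(2)] that(1) by (simp add: f_W)
  have UNIV_W: "UNIV \<in> W" and empty_W: "{} \<notin> W"
    using top bot by (simp_all add: f_W)

  have singleton_W: "{p} \<notin> W" if "p < k" for p
  proof
    assume "{p} \<in> W"
    \<comment> \<open>If \<open>p\<close> is not in \<open>S\<close>, then it is in
      \<open>- S\<close>, so \<open>- S\<close> belongs to \<open>W\<close> and \<open>S\<close>
      does not.\<close>
    have "S \<in> W \<longleftrightarrow> p \<in> S" for S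
      using mono_W[OF \<open>{p} \<in> W\<close>, of S] mono_W[OF \<open>{p} \<in> W\<close>, of "- S"] compl_W[of S] by auto
    then have "f j a = a ! p" if "length a = k" for j a
      using f_W[of j "{i. a ! i}"] that by (simp add: indicator_list_nth)
    then show False using nondict \<open>p < k\<close> by (auto simp: dictatorial_def)
  qed

  obtain U V where U: "U \<in> W" and V: "V \<in> W" and UV: "U \<inter> V \<notin> W"
  proof (rule ccontr)
    assume "\<not> thesis"
    then have inter: "U \<inter> V \<in> W" if "U \<in> W" "V \<in> W" for U V
      using that \<open>\<And>V U. \<lbrakk>U \<in> W; V \<in> W; U \<inter> V \<notin> W\<rbrakk> \<Longrightarrow> thesis\<close> by blast
    \<comment> \<open>Positions are removed one at a time; after \<open>k\<close> removals the set
      acts like the empty one.\<close>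
    have "m \<le> k \<Longrightarrow> - {..<m} \<in> W" for m
    proof (induction m)
      case 0
      then show ?case using UNIV_W by simp
    next
      case (Suc m)
      then have "- {..<m} \<inter> - {m} \<in> W"
        by (intro inter) (auto simp: compl_W singleton_W)
      also have "- {..<m} \<inter> - {m} = - {..<Suc m}" by auto
      finally show ?case .
    qed
    then have "- {..<k} \<in> W" by simp
    moreover have "indicator_list k (- {..<k}) = indicator_list k {}"
      by (rule indicator_list_cong) auto
    ultimately show False using f_W bot by metis
  qed

  \<comment> \<open>The union of any two of the three blocks lies in \<open>W\<close>: it is
    \<open>U\<close>, contains \<open>V\<close>, or is the complement of
    \<open>U \<inter> V\<close>.\<close>
  define g where "g = binary_minor k f d (U \<inter> V) (U - V)"
  have g: "g j [x, y] \<longleftrightarrow> {i. if i \<in> U \<inter> V then d $ j else if i \<in> U - V then x else y} \<in> W" for j x y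
    by (simp add: g_def binary_minor_def f_W)
  have "unanimous 2 (g j)" for j
    unfolding unanimous_def
  proof
    fix b
    have eq: "g j (replicate 2 b) \<longleftrightarrow> {i. if i \<in> U \<inter> V then d $ j else b} \<in> W"
      using g[of j b b] by (simp add: numeral_2_eq_2)
    have "{i. if i \<in> U \<inter> V then d $ j else b} =
      (if d $ j then if b then UNIV else U \<inter> V else if b then - (U \<inter> V) else {})"
      by auto
    then show "g j (replicate 2 b) = b"
      using UNIV_W empty_W UV compl_W[of "U \<inter> V"] by (simp add: eq)
  qed
  then have "dictatorial 2 g"
    unfolding g_def by (intro dict aggregator_binary_minor[OF agg d])
  note neq = dictatorial_2_neq(1)[OF this]
  fix j
  show False
  \<comment> \<open>Component \<open>j\<close> is a disjunction if \<open>d $ j\<close> holds and a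
    conjunction otherwise. Either takes equal values at the two mixed pairs, which no projection
    does.\<close>
  proof (cases "d $ j")
    case True
    have "g j [True, False]"
      unfolding g by (rule mono_W[OF U]) (use True in auto)
    moreover have "g j [False, True]"
      unfolding g by (rule mono_W[OF V]) (use True in auto)
    ultimately show False using neq by blast
  next
    case False
    have "- {i. if i \<in> U \<inter> V then d $ j else if i \<in> U - V then True else False} \<in> W"
      by (rule mono_W[OF V]) (use False in auto)
    moreover have "- {i. if i \<in> U \<inter> V then d $ j else if i \<in> U - V then False else True} \<in> W"
      by (rule mono_W[OF U]) (use False in auto)
    ultimately show False using neq[of j] by (simp only: g compl_W simp_thms)
  qed
qed

theorem theorem5p18:
  fixes D :: "(bool ^ 'n::finite) set"
  assumes "nondegenerate D"
  shows "(\<exists>k f. aggregator D k f \<and> monotone_aggregator k f \<and> \<not> dictatorial k f) \<longleftrightarrow>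
         (\<exists>f. aggregator D 2 f \<and> \<not> dictatorial 2 f)"
proof
  have "D \<noteq> {}"
    using assms by (auto simp: nondegenerate_def)
  then show "\<exists>f. aggregator D 2 f \<and> \<not> dictatorial 2 f"
    if "\<exists>k f. aggregator D k f \<and> monotone_aggregator k f \<and> \<not> dictatorial k f"
    using that not_dictatorial_imp_binary by blast
next
  show "\<exists>k f. aggregator D k f \<and> monotone_aggregator k f \<and> \<not> dictatorial k f"
    if "\<exists>f. aggregator D 2 f \<and> \<not> dictatorial 2 f"
    using that monotone_aggregator_binary unfolding aggregator_def by blast
qed

end
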